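(* Let $\triangle ABC$ be a nondegenerate triangle circumscribed about a central conic $\mathcal{D}$, and let $\mathcal{P}$ be the family of all nondegenerate triangles inscribed in the circumcircle of $\triangle ABC$ and circumscribed about $\mathcal{D}$. Then the quantity $\sin^2 A+\sin^2 B+\sin^2 C$ (with $A,B,C$ the angles of the triangle) takes the same value for all triangles in $\mathcal{P}$ if and only if the circumcenter of $\triangle ABC$ coincides with either the center of $\mathcal{D}$ or one of its foci.
   Context: A central conic is a non-degenerate ellipse or hyperbola. A triangle is circumscribed about a conic if each of its three sidelines is tangent to the conic. *)

theory Defs
  imports "HOL-Analysis.Analysis"
begin

text \<open>Points of the Euclidean plane are modelled as complex numbers.
A central conic is given by its centre c, a unit vector u (direction of the first axis),
semi-axes a, b > 0, and a flag hyp (False: ellipse, True: hyperbola).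
In the coordinates x = (p - c) \<bullet> u, y = (p - c) \<bullet> (i u) its equation is
x^2/a^2 + y^2/b^2 = 1 (ellipse) or x^2/a^2 - y^2/b^2 = 1 (hyperbola).\<close>

definition central_conic :: "complex \<Rightarrow> complex \<Rightarrow> real \<Rightarrow> real \<Rightarrow> bool" where
  "central_conic c u a b \<longleftrightarrow> norm u = 1 \<and> a > 0 \<and> b > 0"

definition conic_sign :: "bool \<Rightarrow> real" where
  "conic_sign hyp = (if hyp then -1 else 1)"

definition conic_eq :: "complex \<Rightarrow> complex \<Rightarrow> real \<Rightarrow> real \<Rightarrow> bool \<Rightarrow> complex \<Rightarrow> real" where
  "conic_eq c u a b hyp p =
     ((p - c) \<bullet> u)\<^sup>2 / a\<^sup>2 + conic_sign hyp * ((p - c) \<bullet> (\<i> * u))\<^sup>2 / b\<^sup>2 - 1"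

definition conic_set :: "complex \<Rightarrow> complex \<Rightarrow> real \<Rightarrow> real \<Rightarrow> bool \<Rightarrow> complex set" where
  "conic_set c u a b hyp = {p. conic_eq c u a b hyp p = 0}"

definition conic_grad :: "complex \<Rightarrow> complex \<Rightarrow> real \<Rightarrow> real \<Rightarrow> bool \<Rightarrow> complex \<Rightarrow> complex" where
  "conic_grad c u a b hyp p =
     of_real (2 * ((p - c) \<bullet> u) / a\<^sup>2) * u
     + of_real (2 * conic_sign hyp * ((p - c) \<bullet> (\<i> * u)) / b\<^sup>2) * (\<i> * u)"

definition tangent_line :: "complex \<Rightarrow> complex \<Rightarrow> real \<Rightarrow> real \<Rightarrow> bool \<Rightarrow> complex \<Rightarrow> complex \<Rightarrow> bool" where
  "tangent_line c u a b hyp P Q \<longleftrightarrow>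
     (\<exists>X \<in> conic_set c u a b hyp. (\<exists>t::real. X = P + of_real t * (Q - P))
        \<and> conic_grad c u a b hyp X \<bullet> (Q - P) = 0)"

definition conic_foci :: "complex \<Rightarrow> complex \<Rightarrow> real \<Rightarrow> real \<Rightarrow> bool \<Rightarrow> complex set" where
  "conic_foci c u a b hyp =
     (if hyp then {c + of_real (sqrt (a\<^sup>2 + b\<^sup>2)) * u, c - of_real (sqrt (a\<^sup>2 + b\<^sup>2)) * u}
      else if b \<le> a then {c + of_real (sqrt (a\<^sup>2 - b\<^sup>2)) * u, c - of_real (sqrt (a\<^sup>2 - b\<^sup>2)) * u}
      else {c + of_real (sqrt (b\<^sup>2 - a\<^sup>2)) * (\<i> * u), c - of_real (sqrt (b\<^sup>2 - a\<^sup>2)) * (\<i> * u)})"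

definition nondegenerate_triangle :: "complex \<Rightarrow> complex \<Rightarrow> complex \<Rightarrow> bool" where
  "nondegenerate_triangle A B C \<longleftrightarrow> \<not> collinear {A, B, C}"

definition circumscribed_about :: "complex \<Rightarrow> complex \<Rightarrow> real \<Rightarrow> real \<Rightarrow> bool \<Rightarrow>
    complex \<Rightarrow> complex \<Rightarrow> complex \<Rightarrow> bool" where
  "circumscribed_about c u a b hyp A B C \<longleftrightarrow>
     tangent_line c u a b hyp A B \<and> tangent_line c u a b hyp B C \<and> tangent_line c u a b hyp C A"

definition circumcenter :: "complex \<Rightarrow> complex \<Rightarrow> complex \<Rightarrow> complex" where
  "circumcenter A B C = (THE M. dist M A = dist M B \<and> dist M B = dist M C)"

definition vertex_angle :: "complex \<Rightarrow> complex \<Rightarrow> complex \<Rightarrow> real" where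
  "vertex_angle A B C = arccos (((A - B) \<bullet> (C - B)) / (norm (A - B) * norm (C - B)))"

definition sin_sq_sum :: "complex \<Rightarrow> complex \<Rightarrow> complex \<Rightarrow> real" where
  "sin_sq_sum A B C =
     (sin (vertex_angle C A B))\<^sup>2 + (sin (vertex_angle A B C))\<^sup>2 + (sin (vertex_angle B C A))\<^sup>2"

end

theory Submission
  imports Defs
begin

text \<open>Normalise the circumcircle to the unit circle and let \<open>f, g\<close> be the foci of the conic,
\<open>k\<close> its centre and \<open>N = f g\<close>. A triangle \<open>x y z\<close> inscribed in the unit circle and circumscribed
about the conic satisfies Morley's relation \<open>x + y + z = 2 k + cnj N * x y z\<close>. Conversely,
for inscribed triangles with this relation, tangency of the sides depends only on the conic
(a Fuss-type identity), which is Poncelet's porism. The sum of the squared sines is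
\<open>(9 - |x + y + z|\<^sup>2) / 4\<close>, so it is constant if \<open>k = 0\<close> or \<open>N = 0\<close>, that is, if the circumcentre
is the centre or a focus. Otherwise \<open>|x + y + z|\<close> varies with \<open>x y z\<close>, and moving \<open>x\<close> slightly
along the circle produces a triangle of the family with a different value.\<close>

section \<open>Tangent lines and the dual conic\<close>

lemma cnj_unit: "norm (z::complex) = 1 \<Longrightarrow> z * cnj z = 1"
  by (simp add: complex_norm_square [symmetric])

lemma inner_complex_cnj: "of_real (z \<bullet> w) = (cnj z * w + z * cnj w) / 2"
  by (simp add: complex_eq_iff inner_complex_def)

lemma inner_ii_frame:
  assumes "norm u = 1"
  shows "(z \<bullet> u) * (w \<bullet> u) + (z \<bullet> (\<i> * u)) * (w \<bullet> (\<i> * u)) = z \<bullet> w"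
proof -
  have u: "(Re u)\<^sup>2 + (Im u)\<^sup>2 = 1"
    using assms by (simp add: cmod_def)
  show ?thesis
    unfolding inner_complex_def using u by simp algebra
qed

lemma frame_cancel:
  assumes "norm u = 1" "z \<bullet> u = w \<bullet> u" "z \<bullet> (\<i> * u) = w \<bullet> (\<i> * u)"
  shows "z = w"
proof -
  have "(z - w) \<bullet> (z - w) = 0"
    using inner_ii_frame [OF assms(1), of "z - w" "z - w"] assms(2,3)
    by (simp add: inner_diff_left)
  then show ?thesis by simp
qed

text \<open>The line is \<open>n \<bullet> (X - c) = d\<close>, and contact at \<open>X\<close>
  means that the gradient there is a multiple of the normal \<open>n\<close>. This makes the
  coordinates of \<open>X\<close> proportional to \<open>n1 * a\<^sup>2\<close> and
  \<open>s * n2 * b\<^sup>2\<close>; the multiplier \<open>l\<close> is then eliminated between the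
  equations of line and conic.\<close>

lemma tangent_line_dual:
  assumes "central_conic c u a b" and "P \<noteq> Q"
  defines "n \<equiv> \<i> * (Q - P)"
  defines "d \<equiv> n \<bullet> (P - c)"
  shows "tangent_line c u a b hyp P Q \<longleftrightarrow>
    d \<noteq> 0 \<and> d\<^sup>2 = a\<^sup>2 * (n \<bullet> u)\<^sup>2 + conic_sign hyp * b\<^sup>2 * (n \<bullet> (\<i> * u))\<^sup>2"
proof -
  define s where "s = conic_sign hyp"
  have s: "s * s = 1" by (simp add: s_def conic_sign_def)
  have u: "norm u = 1" and a: "a > 0" and b: "b > 0"
    using assms(1) by (auto simp: central_conic_def)
  have uu: "u \<bullet> u = 1" "(\<i> * u) \<bullet> (\<i> * u) = 1" "u \<bullet> (\<i> * u) = 0" "(\<i> * u) \<bullet> u = 0"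
    using u by (simp_all add: dot_square_norm norm_mult) (simp_all add: inner_complex_def)
  have nd: "n \<bullet> (Q - P) = 0"
    by (simp add: n_def inner_complex_def algebra_simps)
  have n0: "n \<noteq> 0" using assms(2) by (simp add: n_def)
  define n1 n2 where "n1 = n \<bullet> u" and "n2 = n \<bullet> (\<i> * u)"
  have line: "(\<exists>t::real. X = P + of_real t * (Q - P)) \<longleftrightarrow> n \<bullet> (X - c) = d" for X
  proof
    assume "\<exists>t::real. X = P + of_real t * (Q - P)"
    then obtain t :: real where "X = P + of_real t * (Q - P)" by blast
    then have "X - c = (P - c) + t *\<^sub>R (Q - P)" by (simp add: scaleR_conv_of_real)
    then show "n \<bullet> (X - c) = d"
      by (simp only: d_def inner_add_right inner_scaleR_right nd mult_zero_right add_0_right)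
  next
    assume "n \<bullet> (X - c) = d"
    then have "n \<bullet> (X - P) = 0"
      by (simp add: d_def inner_diff_right)
    then have im: "Im ((X - P) * cnj (Q - P)) = 0"
      by (simp add: n_def inner_complex_def algebra_simps)
    define t where "t = Re ((X - P) / (Q - P))"
    have "(X - P) / (Q - P) = of_real t"
      using im by (simp add: t_def complex_eq_iff complex_div_cnj [of "X - P" "Q - P"])
    then have "X = P + of_real t * (Q - P)"
      using assms(2) by (simp add: field_simps)
    then show "\<exists>t::real. X = P + of_real t * (Q - P)" by blast
  qed
  have grad: "conic_grad c u a b hyp X \<bullet> (Q - P) = 0 \<longleftrightarrow>
      (\<exists>l. ((X - c) \<bullet> u) = l * n1 * a\<^sup>2 \<and> ((X - c) \<bullet> (\<i> * u)) = l * s * n2 * b\<^sup>2)" for X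
  proof -
    define g where "g = conic_grad c u a b hyp X"
    have g1: "g \<bullet> u = 2 * ((X - c) \<bullet> u) / a\<^sup>2"
      and g2: "g \<bullet> (\<i> * u) = 2 * s * ((X - c) \<bullet> (\<i> * u)) / b\<^sup>2"
      unfolding g_def conic_grad_def scaleR_conv_of_real [symmetric]
      by (simp_all add: inner_add_left uu s_def)
    have "g \<bullet> (Q - P) = 0 \<longleftrightarrow> (\<exists>l. g = l *\<^sub>R n)"
    proof
      assume "g \<bullet> (Q - P) = 0"
      then have im: "Im (g * cnj n) = 0"
        by (simp add: n_def inner_complex_def algebra_simps)
      then have "g / n = of_real (Re (g / n))"
        by (simp add: complex_eq_iff complex_div_cnj [of g n])
      then have "g = Re (g / n) *\<^sub>R n"
        using n0 by (metis nonzero_divide_eq_eq scaleR_conv_of_real)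
      then show "\<exists>l. g = l *\<^sub>R n" by blast
    qed (auto simp: nd)
    also have "\<dots> \<longleftrightarrow> (\<exists>l. g \<bullet> u = l * n1 \<and> g \<bullet> (\<i> * u) = l * n2)"
    proof -
      have "g = l *\<^sub>R n \<longleftrightarrow> g \<bullet> u = l * n1 \<and> g \<bullet> (\<i> * u) = l * n2" for l
        using frame_cancel [OF u, of g "l *\<^sub>R n"] by (auto simp: n1_def n2_def)
      then show ?thesis by simp
    qed
    also have "\<dots> \<longleftrightarrow> (\<exists>l. ((X - c) \<bullet> u) = l * n1 * a\<^sup>2 \<and> ((X - c) \<bullet> (\<i> * u)) = l * s * n2 * b\<^sup>2)"
      (is "(\<exists>l. ?L l) \<longleftrightarrow> (\<exists>l. ?R l)")
    proof -
      \<comment> \<open>The factor 2 in the gradient is absorbed into the multiplier.\<close>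
      have "?L (2 * l) \<longleftrightarrow> ?R l" for l
      proof -
        have "2 * ((X - c) \<bullet> u) / a\<^sup>2 = 2 * l * n1 \<longleftrightarrow> ((X - c) \<bullet> u) = l * n1 * a\<^sup>2"
          using a by (auto simp: field_simps)
        moreover have "2 * s * ((X - c) \<bullet> (\<i> * u)) / b\<^sup>2 = 2 * l * n2 \<longleftrightarrow>
            s * ((X - c) \<bullet> (\<i> * u)) = l * n2 * b\<^sup>2"
          using b by (auto simp: field_simps)
        moreover have "s * ((X - c) \<bullet> (\<i> * u)) = l * n2 * b\<^sup>2 \<longleftrightarrow>
            ((X - c) \<bullet> (\<i> * u)) = l * s * n2 * b\<^sup>2"
          using s by algebra
        ultimately show ?thesis by (simp only: g1 g2)
      qed
      moreover have "(\<exists>l. ?L l) \<longleftrightarrow> (\<exists>l. ?L (2 * l))"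
        by (metis field_sum_of_halves mult_2)
      ultimately show ?thesis by blast
    qed
    finally show ?thesis by (simp add: g_def)
  qed
  have nX: "n \<bullet> (X - c) = n1 * ((X - c) \<bullet> u) + n2 * ((X - c) \<bullet> (\<i> * u))" for X
    using inner_ii_frame [OF u, of n "X - c"] by (simp add: n1_def n2_def)
  have on: "X \<in> conic_set c u a b hyp \<longleftrightarrow>
      ((X - c) \<bullet> u)\<^sup>2 / a\<^sup>2 + s * ((X - c) \<bullet> (\<i> * u))\<^sup>2 / b\<^sup>2 = 1" for X
    by (simp add: conic_set_def conic_eq_def s_def)
  have on': "X \<in> conic_set c u a b hyp \<longleftrightarrow> l\<^sup>2 * (a\<^sup>2 * n1\<^sup>2 + s * b\<^sup>2 * n2\<^sup>2) = 1"
    if "(X - c) \<bullet> u = l * n1 * a\<^sup>2" "(X - c) \<bullet> (\<i> * u) = l * s * n2 * b\<^sup>2" for X l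
  proof -
    have "((X - c) \<bullet> u)\<^sup>2 / a\<^sup>2 = l\<^sup>2 * n1\<^sup>2 * a\<^sup>2"
      using a by (simp add: that power_mult_distrib power2_eq_square)
    moreover have "s * ((X - c) \<bullet> (\<i> * u))\<^sup>2 / b\<^sup>2 = (s * s) * (s * l\<^sup>2 * n2\<^sup>2 * b\<^sup>2)"
      using b by (simp add: that power_mult_distrib power2_eq_square)
    ultimately show ?thesis unfolding on s by (simp add: algebra_simps)
  qed
  show ?thesis (is "_ \<longleftrightarrow> ?rhs")
  proof
    assume "tangent_line c u a b hyp P Q"
    then obtain X l where X: "X \<in> conic_set c u a b hyp" "n \<bullet> (X - c) = d"
        and l: "(X - c) \<bullet> u = l * n1 * a\<^sup>2" "(X - c) \<bullet> (\<i> * u) = l * s * n2 * b\<^sup>2"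
      unfolding tangent_line_def by (auto simp: line grad)
    have 1: "l\<^sup>2 * (a\<^sup>2 * n1\<^sup>2 + s * b\<^sup>2 * n2\<^sup>2) = 1"
      using X(1) on' [OF l] by simp
    have 2: "d = l * (a\<^sup>2 * n1\<^sup>2 + s * b\<^sup>2 * n2\<^sup>2)"
      using X(2) unfolding nX l by (simp add: algebra_simps power2_eq_square)
    \<comment> \<open>Besides excluding \<open>d = 0\<close>, this fixes the multiplier as
      \<open>1 / d\<close>, the value used for the converse.\<close>
    have "l * d = 1" using 1 2 by algebra
    moreover have "d\<^sup>2 = a\<^sup>2 * n1\<^sup>2 + s * b\<^sup>2 * n2\<^sup>2" using 1 2 by algebra
    ultimately show ?rhs by (auto simp: s_def n1_def n2_def)
  next
    assume ?rhs
    then have d0: "d \<noteq> 0" and d2: "d\<^sup>2 = a\<^sup>2 * n1\<^sup>2 + s * b\<^sup>2 * n2\<^sup>2"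
      by (auto simp: s_def n1_def n2_def)
    \<comment> \<open>The pole of the line with respect to the conic, which is the point of
      contact.\<close>
    define X where "X = c + (n1 * a\<^sup>2 / d) *\<^sub>R u + (s * n2 * b\<^sup>2 / d) *\<^sub>R (\<i> * u)"
    have l: "(X - c) \<bullet> u = (1/d) * n1 * a\<^sup>2" "(X - c) \<bullet> (\<i> * u) = (1/d) * s * n2 * b\<^sup>2"
      by (simp_all add: X_def inner_add_left uu algebra_simps del: mult_scaleR_right)
    have "n \<bullet> (X - c) = (1/d) * (a\<^sup>2 * n1\<^sup>2 + s * b\<^sup>2 * n2\<^sup>2)"
      unfolding nX l by (simp add: algebra_simps power2_eq_square)
    also have "\<dots> = d" unfolding d2 [symmetric] using d0 by (simp add: power2_eq_square)
    finally have "n \<bullet> (X - c) = d" .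
    moreover have "X \<in> conic_set c u a b hyp"
      unfolding on' [OF l] d2 [symmetric] using d0 by (simp add: field_simps)
    ultimately show "tangent_line c u a b hyp P Q"
      unfolding tangent_line_def using l line grad by blast
  qed
qed

text \<open>The conjugate of a unit number is its inverse. Expressing a chord direction through its
  own conjugate is what turns tangency into a polynomial condition on \<open>p\<close> and
  \<open>q\<close>.\<close>

lemma cnj_chord:
  assumes "norm p = 1" "norm q = 1"
  shows "(q - p) = - (p * q * cnj (q - p))"
  using cnj_unit [OF assms(1)] cnj_unit [OF assms(2)] by (simp, algebra)

section \<open>Tangent chords of the unit circle\<close>

text \<open>The modulus is twice the distance of \<open>k\<close> from the chord \<open>p q\<close> of the unit circle, whose
line is \<open>z + p q * cnj z = p + q\<close>.\<close>
definition chord_offset :: "complex \<Rightarrow> complex \<Rightarrow> complex \<Rightarrow> complex" where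
  "chord_offset k p q = p + q - k - cnj k * p * q"

text \<open>The dual equation of the conic with centre \<open>k\<close>, where \<open>K\<close> is the square of the vector from
the centre to a focus and \<open>S\<close> the sum of the squared semi-axes, the second one counted negatively
for a hyperbola. The lines through the centre satisfying it are the asymptotes, which
are not tangents.\<close>
definition chord_tangent :: "complex \<Rightarrow> complex \<Rightarrow> real \<Rightarrow> complex \<Rightarrow> complex \<Rightarrow> bool" where
  "chord_tangent k K S p q \<longleftrightarrow> chord_offset k p q \<noteq> 0 \<and>
     (chord_offset k p q)\<^sup>2 = K + cnj K * p\<^sup>2 * q\<^sup>2 + 2 * of_real S * p * q"

text \<open>The normal satisfies \<open>w = p * q * cnj w\<close>, so each inner product with
  \<open>w\<close> is \<open>cnj w / 2\<close> times a polynomial in \<open>p\<close> and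
  \<open>q\<close>. The common factor \<open>(cnj w)\<^sup>2 / 4\<close> then cancels from the dual
  equation.\<close>

lemma tangent_line_chord:
  fixes R :: real and M p q :: complex and hyp :: bool
  assumes cc: "central_conic c u a b" and R: "R > 0"
    and p: "norm p = 1" and q: "norm q = 1" and pq: "p \<noteq> q"
  defines "s \<equiv> conic_sign hyp"
  shows "tangent_line c u a b hyp (M + of_real R * p) (M + of_real R * q) \<longleftrightarrow>
    chord_tangent ((c - M) / of_real R) (of_real ((a\<^sup>2 - s * b\<^sup>2) / R\<^sup>2) * u\<^sup>2)
      ((a\<^sup>2 + s * b\<^sup>2) / R\<^sup>2) p q"
proof -
  define k where "k = (c - M) / of_real R"
  define K where "K = of_real ((a\<^sup>2 - s * b\<^sup>2) / R\<^sup>2) * u\<^sup>2"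
  define S where "S = (a\<^sup>2 + s * b\<^sup>2) / R\<^sup>2"
  define D where "D = chord_offset k p q"
  define w where "w = \<i> * (q - p)"
  define n where "n = \<i> * ((M + of_real R * q) - (M + of_real R * p))"
  define d where "d = n \<bullet> (M + of_real R * p - c)"
  have w0: "w \<noteq> 0" using pq by (simp add: w_def)
  have pp: "p * cnj p = 1" and qq: "q * cnj q = 1"
    using p q by (simp_all add: cnj_unit)
  have w: "w = p * q * cnj w"
  proof -
    have "w = \<i> * - (p * q * cnj (q - p))"
      unfolding w_def by (rule arg_cong [OF cnj_chord [OF p q]])
    also have "\<dots> = p * q * cnj w" by (simp add: w_def algebra_simps)
    finally show ?thesis .
  qed
  have n: "n = R *\<^sub>R w" by (simp add: n_def w_def scaleR_conv_of_real algebra_simps)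
  have Mpc: "M + of_real R * p - c = R *\<^sub>R (p - k)"
    using R by (simp add: k_def scaleR_conv_of_real field_simps)
  have d: "d = R\<^sup>2 * (w \<bullet> (p - k))"
    unfolding d_def n Mpc by (simp add: power2_eq_square)
  have wpk: "of_real (w \<bullet> (p - k)) = cnj w * D / 2"
  proof -
    have e: "w * cnj (p - k) = cnj w * (q - cnj k * p * q)"
      using w pp by (simp, algebra)
    show ?thesis
      by (simp only: inner_complex_cnj e) (simp add: D_def chord_offset_def algebra_simps)
  qed
  have wu: "of_real (w \<bullet> u) = cnj w * (u + p * q * cnj u) / 2"
    unfolding inner_complex_cnj by (subst (2) w) (simp add: algebra_simps)
  have wiu: "of_real (w \<bullet> (\<i> * u)) = \<i> * cnj w * (u - p * q * cnj u) / 2"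
    unfolding inner_complex_cnj by (subst (2) w) (simp add: algebra_simps)
  have d0: "d \<noteq> 0 \<longleftrightarrow> D \<noteq> 0"
  proof -
    have "d = 0 \<longleftrightarrow> complex_of_real (w \<bullet> (p - k)) = 0" using R by (simp add: d)
    also have "\<dots> \<longleftrightarrow> D = 0" unfolding wpk using w0 by simp
    finally show ?thesis by simp
  qed
  have uu: "u * cnj u = 1" using cc by (simp add: cnj_unit central_conic_def)
  have "d\<^sup>2 = a\<^sup>2 * (n \<bullet> u)\<^sup>2 + s * b\<^sup>2 * (n \<bullet> (\<i> * u))\<^sup>2 \<longleftrightarrow>
      (w \<bullet> (p - k))\<^sup>2 = (a\<^sup>2 * (w \<bullet> u)\<^sup>2 + s * b\<^sup>2 * (w \<bullet> (\<i> * u))\<^sup>2) / R\<^sup>2"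
  proof -
    have 1: "d\<^sup>2 = R\<^sup>2 * (R\<^sup>2 * (w \<bullet> (p - k))\<^sup>2)"
      unfolding d by (simp add: power_mult_distrib power2_eq_square)
    have 2: "a\<^sup>2 * (n \<bullet> u)\<^sup>2 + s * b\<^sup>2 * (n \<bullet> (\<i> * u))\<^sup>2 =
        R\<^sup>2 * (a\<^sup>2 * (w \<bullet> u)\<^sup>2 + s * b\<^sup>2 * (w \<bullet> (\<i> * u))\<^sup>2)"
      unfolding n by (simp add: power_mult_distrib algebra_simps del: mult_scaleR_right)
    have 3: "R\<^sup>2 * X = R\<^sup>2 * Y \<longleftrightarrow> X = Y" "R\<^sup>2 * X = Y \<longleftrightarrow> X = Y / R\<^sup>2" for X Y :: real
      using R by (auto simp: field_simps)
    show ?thesis unfolding 1 2 3(1) by (rule 3(2))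
  qed
  also have "\<dots> \<longleftrightarrow> complex_of_real ((w \<bullet> (p - k))\<^sup>2) =
      of_real ((a\<^sup>2 * (w \<bullet> u)\<^sup>2 + s * b\<^sup>2 * (w \<bullet> (\<i> * u))\<^sup>2) / R\<^sup>2)"
    by (simp only: of_real_eq_iff)
  also have "complex_of_real ((w \<bullet> (p - k))\<^sup>2) = (cnj w)\<^sup>2 / 4 * D\<^sup>2"
    by (simp add: wpk power_mult_distrib power_divide)
  also have "complex_of_real ((a\<^sup>2 * (w \<bullet> u)\<^sup>2 + s * b\<^sup>2 * (w \<bullet> (\<i> * u))\<^sup>2) / R\<^sup>2)
      = (cnj w)\<^sup>2 / 4 * ((of_real (a\<^sup>2) * (u + p * q * cnj u)\<^sup>2
          - of_real (s * b\<^sup>2) * (u - p * q * cnj u)\<^sup>2) / of_real (R\<^sup>2))"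
  proof -
    have "(\<alpha> * (W * P / 2)\<^sup>2 + \<beta> * (\<i> * W * Q / 2)\<^sup>2) / \<rho> = W\<^sup>2 / 4 * ((\<alpha> * P\<^sup>2 - \<beta> * Q\<^sup>2) / \<rho>)"
      for \<alpha> \<beta> \<rho> W P Q :: complex
      by (simp add: power_mult_distrib power_divide algebra_simps add_divide_distrib diff_divide_distrib)
    then show ?thesis
      by (simp only: of_real_divide of_real_add of_real_mult of_real_power wu wiu)
  qed
  also have "(of_real (a\<^sup>2) * (u + p * q * cnj u)\<^sup>2
          - of_real (s * b\<^sup>2) * (u - p * q * cnj u)\<^sup>2) / of_real (R\<^sup>2)
      = K + cnj K * p\<^sup>2 * q\<^sup>2 + 2 * of_real S * p * q"
  proof -
    have 1: "of_real (R\<^sup>2) * K = of_real (a\<^sup>2 - s * b\<^sup>2) * u\<^sup>2"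
      "of_real (R\<^sup>2) * cnj K = of_real (a\<^sup>2 - s * b\<^sup>2) * (cnj u)\<^sup>2"
      "of_real (R\<^sup>2) * complex_of_real S = of_real (a\<^sup>2 + s * b\<^sup>2)"
      using R by (simp_all add: K_def S_def)
    have "of_real (R\<^sup>2) * (K + cnj K * p\<^sup>2 * q\<^sup>2 + 2 * of_real S * p * q) =
      (of_real (R\<^sup>2) * K) + (of_real (R\<^sup>2) * cnj K) * p\<^sup>2 * q\<^sup>2
        + 2 * (of_real (R\<^sup>2) * of_real S) * p * q" by (simp add: algebra_simps)
    also have "\<dots> = of_real (a\<^sup>2) * (u + p * q * cnj u)\<^sup>2
          - of_real (s * b\<^sup>2) * (u - p * q * cnj u)\<^sup>2"
      unfolding 1 of_real_diff of_real_add using uu by algebra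
    finally show ?thesis using R by (simp add: field_simps)
  qed
  also have "(cnj w)\<^sup>2 / 4 * D\<^sup>2 = (cnj w)\<^sup>2 / 4 * (K + cnj K * p\<^sup>2 * q\<^sup>2 + 2 * of_real S * p * q)
      \<longleftrightarrow> D\<^sup>2 = K + cnj K * p\<^sup>2 * q\<^sup>2 + 2 * of_real S * p * q"
    using w0 by simp
  finally have eq: "d\<^sup>2 = a\<^sup>2 * (n \<bullet> u)\<^sup>2 + s * b\<^sup>2 * (n \<bullet> (\<i> * u))\<^sup>2 \<longleftrightarrow>
      D\<^sup>2 = K + cnj K * p\<^sup>2 * q\<^sup>2 + 2 * of_real S * p * q" .
  have ne: "M + of_real R * p \<noteq> M + of_real R * q" using pq R by simp
  show ?thesis
    unfolding tangent_line_dual [OF cc ne] chord_tangent_def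
    using eq d0 unfolding d_def n_def D_def k_def K_def S_def s_def by blast
qed

text \<open>For a fixed vertex the tangency condition is quadratic in the other endpoint, so Vieta's
formulas apply to the two remaining vertices.\<close>
lemma tangent_triangle_sum:
  assumes "chord_tangent k K S x y" "chord_tangent k K S y z" "chord_tangent k K S x z"
    and "x \<noteq> y" "y \<noteq> z" "x \<noteq> z"
  shows "x + y + z = 2 * k + cnj (k\<^sup>2 - K) * (x * y * z)"
proof -
  define k' K' S' where "k' = cnj k" and "K' = cnj K" and "S' = complex_of_real S"
  note defs = chord_tangent_def chord_offset_def k'_def [symmetric] K'_def [symmetric] S'_def [symmetric]
  define N N' where "N = k\<^sup>2 - K" and "N' = k'\<^sup>2 - K'"
  define A B C where "A = (\<lambda>t. 1 - 2 * k' * t + N' * t\<^sup>2)"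
    and "B = (\<lambda>t. 2 * t - 2 * k - 2 * k' * t\<^sup>2 + 2 * (k * k' - S') * t)"
    and "C = (\<lambda>t. t\<^sup>2 - 2 * k * t + N)"
  \<comment> \<open>Tangency is symmetric in the endpoints, so it is quadratic in either one, with
    coefficients evaluated at the other.\<close>
  have F: "A p * q\<^sup>2 + B p * q + C p = 0" "A q * p\<^sup>2 + B q * p + C q = 0"
    if "chord_tangent k K S p q" for p q
    using that unfolding defs A_def B_def C_def N_def N'_def by algebra+
  have viete: "q * r * A p = C p" if "A p * q\<^sup>2 + B p * q + C p = 0"
    "A p * r\<^sup>2 + B p * r + C p = 0" "q \<noteq> r" for p q r
  proof -
    have "(q - r) * (C p - q * r * A p) = 0" using that(1,2) by algebra
    then show ?thesis using that(3) by simp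
  qed
  have 1: "y * z * A x = C x"
    using viete F(1) assms by blast
  have 2: "x * z * A y = C y"
    using viete F assms by metis
  \<comment> \<open>Subtracting \<open>2\<close> from \<open>1\<close> cancels the terms linear in
    \<open>k'\<close> and leaves a factor \<open>x - y\<close>.\<close>
  have "(x - y) * (x + y + z - 2 * k - N' * (x * y * z)) = 0"
    using 1 2 unfolding A_def C_def by algebra
  then have "x + y + z - 2 * k = N' * (x * y * z)" using assms(4) by simp
  moreover have "N' = cnj (k\<^sup>2 - K)" by (simp add: N'_def k'_def K'_def)
  ultimately show ?thesis by (simp only: diff_eq_eq add.commute)
qed

text \<open>The failure of the dual equation is \<open>x * y\<close> times a number depending on the
  conic alone. Hence one tangent side of one such triangle makes this number vanish, and the
  equation then holds for the sides of every other such triangle.\<close>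

lemma chord_defect:
  assumes "norm x = 1" "norm y = 1" "norm z = 1"
    and "x + y + z = 2 * k + cnj (k\<^sup>2 - K) * (x * y * z)"
  shows "(chord_offset k x y)\<^sup>2 - (K + cnj K * x\<^sup>2 * y\<^sup>2 + 2 * of_real S * x * y)
    = x * y * (1 + (k\<^sup>2 - K) * cnj (k\<^sup>2 - K) - 2 * k * cnj k - 2 * of_real S)"
proof -
  define N N' where "N = k\<^sup>2 - K" and "N' = cnj N"
  \<comment> \<open>Conjugates become separate variables tied by \<open>x * X = 1\<close>, so that
    the claims are polynomial identities.\<close>
  define X Y Z k' where "X = cnj x" and "Y = cnj y" and "Z = cnj z" and "k' = cnj k"
  define K' where "K' = cnj K"
  have K: "K = k\<^sup>2 - N" "K' = k'\<^sup>2 - N'" by (simp_all add: N_def N'_def k'_def K'_def)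
  have u: "x * X = 1" "y * Y = 1" "z * Z = 1"
    using assms(1-3) by (simp_all add: cnj_unit X_def Y_def Z_def)
  have s: "x + y + z = 2 * k + N' * (x * y * z)"
    using assms(4) by (simp add: N_def N'_def)
  have s': "X + Y + Z = 2 * k' + N * (X * Y * Z)"
    using arg_cong [OF s, of cnj] by (simp add: N'_def X_def Y_def Z_def k'_def)
  \<comment> \<open>The conjugated relation, multiplied by \<open>x * y * z\<close>.\<close>
  have s2: "x * y + y * z + x * z = 2 * k' * (x * y * z) + N"
    using s' u by algebra
  have e: "(x + y - k - k' * x * y)\<^sup>2 - (K + K' * x\<^sup>2 * y\<^sup>2 + 2 * of_real S * x * y)
    = x * y * (1 + N * N' - 2 * k * k' - 2 * of_real S)"
  proof -
    \<comment> \<open>Here \<open>z\<close> is eliminated: \<open>s\<close> reads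
      \<open>z * (1 - N' * x * y) = 2 * k - x - y\<close>, and \<open>s2\<close> reads
      \<open>z * (x + y - 2 * k' * x * y) = N - x * y\<close>.\<close>
    have "(x + y)\<^sup>2 - 2 * (x + y) * (k + k' * (x * y)) + N + N' * (x * y)\<^sup>2 + 4 * k * k' * (x * y) 
       - x * y * (1 + N * N') = 0"
      using s s2 by algebra
    then show ?thesis using K by algebra
  qed
  show ?thesis
    unfolding chord_offset_def N_def [symmetric] N'_def [symmetric] k'_def [symmetric] K'_def [symmetric]
    by (rule e)
qed

lemma chord_tangent_commute: "chord_tangent k K S p q \<longleftrightarrow> chord_tangent k K S q p"
  unfolding chord_tangent_def chord_offset_def by (simp add: algebra_simps)

text \<open>The expression below factors as \<open>(1 - cnj f * x) * (1 - cnj g * x)\<close> with the foci \<open>f, g\<close>.\<close>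
lemma vertex_not_focus:
  assumes "chord_tangent k K S x y" "norm x = 1" "norm y = 1" "K * cnj K \<noteq> (of_real S)\<^sup>2"
  shows "1 - 2 * cnj k * x + cnj (k\<^sup>2 - K) * x\<^sup>2 \<noteq> 0"
proof
  define k' K' X S' where "k' = cnj k" and "K' = cnj K" and "X = cnj x" and "S' = complex_of_real S"
  note defs = k'_def [symmetric] K'_def [symmetric] X_def [symmetric] S'_def [symmetric]
  assume "1 - 2 * cnj k * x + cnj (k\<^sup>2 - K) * x\<^sup>2 = 0"
  then have A: "1 - 2 * k' * x + (k'\<^sup>2 - K') * x\<^sup>2 = 0"
    by (simp add: k'_def K'_def)
  have x: "x * X = 1" using assms(2) by (simp add: X_def cnj_unit)
  have "1 - 2 * k * X + (k\<^sup>2 - K) * X\<^sup>2 = 0"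
    using arg_cong [OF A, of cnj] by (simp add: k'_def K'_def X_def)
  \<comment> \<open>So \<open>x\<close> would be a focus, as \<open>K\<close> is the square of the
    vector from the centre to a focus.\<close>
  then have K: "K = (k - x)\<^sup>2" using x by algebra
  have K': "K' = (k' - X)\<^sup>2" using A x by algebra
  have e: "(x + y - k - k' * x * y)\<^sup>2 = K + K' * x\<^sup>2 * y\<^sup>2 + 2 * S' * x * y"
    using assms(1) unfolding chord_tangent_def chord_offset_def defs by blast
  have "x * y * (S' - (k - x) * (k' - X)) = 0"
  proof -
    \<comment> \<open>The chord offset is now \<open>-((k - x) + x * y * (k' - X))\<close>;
      comparing its square with \<open>e\<close> leaves only the mixed term.\<close>
    have "2 * (x * y * (S' - (k - x) * (k' - X))) = 0"
      using e x unfolding K K' by algebra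
    then show ?thesis by simp
  qed
  then have "S' = (k - x) * (k' - X)" using assms(2,3) by auto
  then have "K * K' = S'\<^sup>2" unfolding K K' by algebra
  then show False using assms(4) by (simp add: K'_def S'_def)
qed

section \<open>Inscribed triangles\<close>

lemma nondegenerate_triangle_iff:
  "nondegenerate_triangle A B C \<longleftrightarrow> Im (cnj (B - A) * (C - A)) \<noteq> 0"
proof -
  have "collinear {A, B, C} \<longleftrightarrow> collinear {B, A, C}" by (simp only: insert_commute)
  also have "\<dots> \<longleftrightarrow> collinear {0, B - A, C - A}" by (rule collinear_3) (simp add: NO_MATCH_def)
  also have "\<dots> \<longleftrightarrow> B - A = 0 \<or> C - A = 0 \<or> (\<exists>t. C - A = t *\<^sub>R (B - A))"
    by (rule collinear_lemma)
  also have "\<dots> \<longleftrightarrow> Im (cnj (B - A) * (C - A)) = 0"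
  proof
    assume "B - A = 0 \<or> C - A = 0 \<or> (\<exists>t. C - A = t *\<^sub>R (B - A))"
    then show "Im (cnj (B - A) * (C - A)) = 0"
    proof (elim disjE exE)
      fix t assume e: "C - A = t *\<^sub>R (B - A)"
      show ?thesis unfolding e by (simp add: algebra_simps)
    qed simp_all
  next
    assume im: "Im (cnj (B - A) * (C - A)) = 0"
    show "B - A = 0 \<or> C - A = 0 \<or> (\<exists>t. C - A = t *\<^sub>R (B - A))"
    proof (cases "B - A = 0")
      case False
      have "(C - A) / (B - A) = of_real (Re ((C - A) / (B - A)))"
        using im by (simp add: complex_eq_iff complex_div_cnj [of "C - A" "B - A"] mult.commute)
      then have "C - A = Re ((C - A) / (B - A)) *\<^sub>R (B - A)"
        using False by (metis nonzero_divide_eq_eq scaleR_conv_of_real)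
      then show ?thesis by blast
    qed simp
  qed
  finally show ?thesis by (simp add: nondegenerate_triangle_def)
qed

lemma nondegenerate_triangle_distinct:
  "nondegenerate_triangle A B C \<Longrightarrow> A \<noteq> B \<and> B \<noteq> C \<and> A \<noteq> C"
  by (auto simp: nondegenerate_triangle_def insert_commute collinear_2)

text \<open>On the unit circle, collinearity forces \<open>(x - y) * (y - z) * (z - x) = 0\<close>;
  passing to radius \<open>R\<close> only multiplies the area by \<open>R\<^sup>2\<close>.\<close>

lemma nondegenerate_triangle_inscribed:
  fixes R :: real
  assumes "norm x = 1" "norm y = 1" "norm z = 1" "x \<noteq> y" "y \<noteq> z" "x \<noteq> z" "R > 0"
  shows "nondegenerate_triangle (M + of_real R * x) (M + of_real R * y) (M + of_real R * z)"
proof -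
  define X Y Z where "X = cnj x" and "Y = cnj y" and "Z = cnj z"
  have u: "x * X = 1" "y * Y = 1" "z * Z = 1"
    using assms(1-3) by (simp_all add: cnj_unit X_def Y_def Z_def)
  have "Im (cnj (y - x) * (z - x)) \<noteq> 0"
  proof
    assume "Im (cnj (y - x) * (z - x)) = 0"
    then have "cnj (cnj (y - x) * (z - x)) = cnj (y - x) * (z - x)"
      by (simp only: complex_is_Real_iff [symmetric] Reals_cnj_iff)
    then have "(y - x) * (Z - X) = (Y - X) * (z - x)"
      by (simp add: X_def Y_def Z_def)
    then have "(x - y) * (y - z) * (z - x) = 0" using u by algebra
    then show False using assms(4-6) by simp
  qed
  moreover have "cnj ((M + of_real R * y) - (M + of_real R * x)) * ((M + of_real R * z) - (M + of_real R * x))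
      = of_real (R\<^sup>2) * (cnj (y - x) * (z - x))"
    by (simp add: algebra_simps power2_eq_square)
  ultimately show ?thesis
    using assms(7) by (simp add: nondegenerate_triangle_iff Im_complex_of_real del: complex_cnj_diff of_real_power)
qed

lemma dist_eq_iff_linear:
  fixes M A B :: complex
  shows "dist M A = dist M B \<longleftrightarrow>
    Re M * (Re B - Re A) + Im M * (Im B - Im A) = ((norm B)\<^sup>2 - (norm A)\<^sup>2) / 2"
proof -
  have "dist M A = dist M B \<longleftrightarrow> (dist M A)\<^sup>2 = (dist M B)\<^sup>2"
    by (simp add: power2_eq_iff_nonneg)
  also have "\<dots> \<longleftrightarrow> Re M * (Re B - Re A) + Im M * (Im B - Im A) = ((norm B)\<^sup>2 - (norm A)\<^sup>2) / 2"
    by (simp add: dist_norm cmod_power2 power2_diff algebra_simps)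
  finally show ?thesis .
qed

text \<open>Equidistance is a linear system for the coordinates of the centre. Its determinant
  \<open>d\<close> is twice the signed area, so the solution is unique and the definite description
  is justified.\<close>

lemma circumcenter_equidistant:
  assumes "nondegenerate_triangle A B C"
  defines "M \<equiv> circumcenter A B C"
  shows "dist M A = dist M B" "dist M B = dist M C"
proof -
  define p q r t where "p = Re B - Re A" and "q = Im B - Im A" and "r = Re C - Re A" and "t = Im C - Im A"
  define \<alpha> \<beta> where "\<alpha> = ((norm B)\<^sup>2 - (norm A)\<^sup>2) / 2" and "\<beta> = ((norm C)\<^sup>2 - (norm A)\<^sup>2) / 2"
  define d where "d = p * t - q * r"
  have d: "d \<noteq> 0"
    using assms(1) by (simp add: nondegenerate_triangle_iff d_def p_def q_def r_def t_def algebra_simps)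
  have lin: "dist M A = dist M B \<and> dist M B = dist M C \<longleftrightarrow>
      Re M * p + Im M * q = \<alpha> \<and> Re M * r + Im M * t = \<beta>" for M
  proof -
    have "dist M A = dist M B \<and> dist M B = dist M C \<longleftrightarrow> dist M A = dist M B \<and> dist M A = dist M C"
      by auto
    then show ?thesis
      by (simp only: dist_eq_iff_linear p_def q_def r_def t_def \<alpha>_def \<beta>_def)
  qed
  have solve: "a * p + b * q = \<alpha> \<and> a * r + b * t = \<beta> \<longleftrightarrow> a = (\<alpha> * t - \<beta> * q) / d \<and> b = (p * \<beta> - r * \<alpha>) / d" for a b
  proof
    assume "a * p + b * q = \<alpha> \<and> a * r + b * t = \<beta>"
    then have h: "\<alpha> = a * p + b * q" "\<beta> = a * r + b * t" by auto
    have "a * d = \<alpha> * t - \<beta> * q" "b * d = p * \<beta> - r * \<alpha>"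
      unfolding d_def h by (simp_all add: algebra_simps)
    then show "a = (\<alpha> * t - \<beta> * q) / d \<and> b = (p * \<beta> - r * \<alpha>) / d"
      using d by (simp add: field_simps)
  next
    assume "a = (\<alpha> * t - \<beta> * q) / d \<and> b = (p * \<beta> - r * \<alpha>) / d"
    then have h: "a * d = \<alpha> * t - \<beta> * q" "b * d = p * \<beta> - r * \<alpha>"
      using d by simp_all
    have "d * (a * p + b * q) = (a * d) * p + (b * d) * q" "d * (a * r + b * t) = (a * d) * r + (b * d) * t"
      by (simp_all add: algebra_simps)
    then have "d * (a * p + b * q) = d * \<alpha>" "d * (a * r + b * t) = d * \<beta>"
      unfolding h by (simp_all add: d_def algebra_simps)
    then show "a * p + b * q = \<alpha> \<and> a * r + b * t = \<beta>" using d by simp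
  qed
  have "\<exists>!M. dist M A = dist M B \<and> dist M B = dist M C"
    unfolding lin solve by (rule ex1I [of _ "Complex ((\<alpha> * t - \<beta> * q) / d) ((p * \<beta> - r * \<alpha>) / d)"]) (auto simp: complex_eq_iff)
  then have "dist M A = dist M B \<and> dist M B = dist M C"
    unfolding M_def circumcenter_def by (rule theI')
  then show "dist M A = dist M B" "dist M B = dist M C" by auto
qed

text \<open>The law of sines with circumradius 1, angles being invariant under scaling. The Gram
  determinant of \<open>f\<close> and \<open>g\<close> treats acute and obtuse angles alike.\<close>

lemma sin_sq_vertex_angle_inscribed:
  fixes R :: real
  assumes "norm x = 1" "norm y = 1" "norm z = 1" "x \<noteq> y" "y \<noteq> z" "R > 0"
  shows "(sin (vertex_angle (M + of_real R * x) (M + of_real R * y) (M + of_real R * z)))\<^sup>2 = (norm (x - z))\<^sup>2 / 4"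
proof -
  define X Y Z where "X = cnj x" and "Y = cnj y" and "Z = cnj z"
  have u: "x * X = 1" "y * Y = 1" "z * Z = 1"
    using assms(1-3) by (simp_all add: cnj_unit X_def Y_def Z_def)
  define f g where "f = x - y" and "g = z - y"
  have fg: "norm f > 0" "norm g > 0" using assms by (auto simp: f_def g_def)
  define r where "r = (f \<bullet> g) / (norm f * norm g)"
  have "(M + of_real R * x) - (M + of_real R * y) = R *\<^sub>R f"
    "(M + of_real R * z) - (M + of_real R * y) = R *\<^sub>R g"
    by (simp_all add: f_def g_def scaleR_conv_of_real algebra_simps)
  then have "vertex_angle (M + of_real R * x) (M + of_real R * y) (M + of_real R * z) = arccos r"
    using assms(6) by (simp add: vertex_angle_def r_def)
  moreover have "\<bar>r\<bar> \<le> 1"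
    using Cauchy_Schwarz_ineq2 [of f g] fg by (simp add: r_def)
  ultimately have sin: "(sin (vertex_angle (M + of_real R * x) (M + of_real R * y) (M + of_real R * z)))\<^sup>2 = 1 - r\<^sup>2"
    by (simp add: sin_squared_eq cos_arccos_abs)
  have "4 * ((norm f)\<^sup>2 * (norm g)\<^sup>2 - (f \<bullet> g)\<^sup>2) = (norm (x - z))\<^sup>2 * ((norm f)\<^sup>2 * (norm g)\<^sup>2)"
  proof -
    have "complex_of_real (4 * ((norm f)\<^sup>2 * (norm g)\<^sup>2 - (f \<bullet> g)\<^sup>2))
        = 4 * ((f * cnj f) * (g * cnj g) - ((cnj f * g + f * cnj g) / 2)\<^sup>2)"
      by (simp only: of_real_mult of_real_diff of_real_power complex_norm_square [symmetric] inner_complex_cnj) simp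
    also have "\<dots> = - (cnj f * g - f * cnj g)\<^sup>2"
      by (simp add: field_simps power2_eq_square)
    also have "\<dots> = - ((X - Y) * (z - y) - (x - y) * (Z - Y))\<^sup>2"
      by (simp add: f_def g_def X_def Y_def Z_def)
    \<comment> \<open>The area formula for circumradius 1: four times the area is the product of the
      three sides.\<close>
    also have "\<dots> = ((x - z) * (X - Z)) * (((x - y) * (X - Y)) * ((z - y) * (Z - Y)))"
      using u by algebra
    also have "\<dots> = ((x - z) * cnj (x - z)) * ((f * cnj f) * (g * cnj g))"
      by (simp add: f_def g_def X_def Y_def Z_def)
    also have "\<dots> = complex_of_real ((norm (x - z))\<^sup>2 * ((norm f)\<^sup>2 * (norm g)\<^sup>2))"
      by (simp only: of_real_mult of_real_power complex_norm_square [symmetric])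
    finally show ?thesis unfolding of_real_eq_iff .
  qed
  then have "1 - r\<^sup>2 = (norm (x - z))\<^sup>2 / 4"
    using fg by (simp add: r_def power_divide power_mult_distrib field_simps)
  then show ?thesis using sin by simp
qed

lemma sin_sq_sum_inscribed:
  fixes R :: real
  assumes "norm x = 1" "norm y = 1" "norm z = 1" "x \<noteq> y" "y \<noteq> z" "x \<noteq> z" "R > 0"
  shows "sin_sq_sum (M + of_real R * x) (M + of_real R * y) (M + of_real R * z) = (9 - (norm (x + y + z))\<^sup>2) / 4"
proof -
  have u: "x \<bullet> x = 1" "y \<bullet> y = 1" "z \<bullet> z = 1"
    using assms(1-3) by (simp_all add: dot_square_norm)
  have "(norm (x - z))\<^sup>2 + (norm (y - x))\<^sup>2 + (norm (z - y))\<^sup>2 = 9 - (norm (x + y + z))\<^sup>2"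
    by (simp add: power2_norm_eq_inner inner_add_left inner_add_right inner_diff_left inner_diff_right u inner_commute)
  moreover have "sin_sq_sum (M + of_real R * x) (M + of_real R * y) (M + of_real R * z)
    = (norm (z - y))\<^sup>2 / 4 + (norm (x - z))\<^sup>2 / 4 + (norm (y - x))\<^sup>2 / 4"
    unfolding sin_sq_sum_def using assms by (simp add: sin_sq_vertex_angle_inscribed)
  ultimately show ?thesis by simp
qed

section \<open>Foci\<close>

text \<open>In each case the foci are \<open>c + g\<close> and \<open>c - g\<close>, hence
  determined by \<open>g\<^sup>2\<close>. If \<open>b > a\<close> in an ellipse, the sign of
  \<open>a\<^sup>2 - b\<^sup>2\<close> is accounted for by
  \<open>(\<i> * u)\<^sup>2 = - u\<^sup>2\<close>.\<close>

lemma conic_foci_iff: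
  assumes "a > 0" "b > 0"
  shows "M \<in> conic_foci c u a b hyp \<longleftrightarrow> (M - c)\<^sup>2 = of_real (a\<^sup>2 - conic_sign hyp * b\<^sup>2) * u\<^sup>2"
proof -
  have sq: "M \<in> {c + g, c - g} \<longleftrightarrow> (M - c)\<^sup>2 = g\<^sup>2" for g :: complex
    by (auto simp: power2_eq_iff algebra_simps)
  have r: "(complex_of_real (sqrt t))\<^sup>2 = of_real t" if "t \<ge> 0" for t
    using that by (simp flip: of_real_power)
  show ?thesis
  proof (cases hyp)
    case True
    then show ?thesis by (simp only: conic_foci_def sq if_True power_mult_distrib r conic_sign_def) (simp add: r flip: of_real_power)
  next
    case False
    show ?thesis
    proof (cases "b \<le> a")
      case True
      then have "b\<^sup>2 \<le> a\<^sup>2" using assms by (simp add: power_mono)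
      then show ?thesis using False True
        by (simp only: conic_foci_def sq if_True if_False power_mult_distrib conic_sign_def) (simp add: r del: of_real_diff)
    next
      case F: False
      then have "a\<^sup>2 \<le> b\<^sup>2" using assms by (simp add: power_mono)
      then show ?thesis using False F
        by (simp only: conic_foci_def sq if_True if_False power_mult_distrib conic_sign_def) (simp add: r del: of_real_diff, metis minus_diff_eq mult_minus_left of_real_minus)
    qed
  qed
qed

section \<open>Perturbing a triangle of the family\<close>

text \<open>Dividing by a square root \<open>\<nu>\<close> of \<open>v\<close> makes the sum a real
  number \<open>r\<close>. The quotients of the roots by \<open>\<nu>\<close> are the conjugate
  points of the unit circle with real part \<open>r / 2\<close>, distinct because
  \<open>\<bar>r\<bar> < 2\<close>.\<close>

lemma unit_roots_quadratic:
  fixes v w :: complex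
  assumes "norm v = 1" "w = v * cnj w" "norm w < 2"
  obtains y z where "norm y = 1" "norm z = 1" "y \<noteq> z" "y + z = w" "y * z = v"
proof -
  define \<nu> where "\<nu> = csqrt v"
  have \<nu>2: "\<nu> * \<nu> = v"
    unfolding \<nu>_def by (metis power2_csqrt power2_eq_square)
  have "norm \<nu> * norm \<nu> = 1"
    using assms(1) \<nu>2 by (metis norm_mult)
  then have \<nu>: "norm \<nu> = 1"
    by (metis abs_norm_cancel power2_eq_1_iff power2_eq_square abs_1 abs_minus_cancel)
  then have \<nu>c: "\<nu> * cnj \<nu> = 1" by (rule cnj_unit)
  have "cnj (w * cnj \<nu>) = w * cnj \<nu>"
    using assms(2) \<nu>2 \<nu>c by (simp, algebra)
  then have "w * cnj \<nu> \<in> \<real>" by (simp add: Reals_cnj_iff)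
  then obtain r where r: "w * cnj \<nu> = complex_of_real r" by (auto elim: Reals_cases)
  have w: "w = of_real r * \<nu>" using r \<nu>c by (metis mult.assoc mult.commute mult.right_neutral)
  have "\<bar>r\<bar> < 2" using assms(3) by (simp add: w norm_mult \<nu>)
  then have r2: "r\<^sup>2 < 4" using abs_square_less_1 [of "r / 2"] by (simp add: power_divide)
  define h where "h = sqrt (1 - r\<^sup>2 / 4)"
  have h: "h > 0" "h\<^sup>2 = 1 - r\<^sup>2 / 4" using r2 by (simp_all add: h_def)
  define y z where "y = \<nu> * Complex (r/2) h" and "z = \<nu> * Complex (r/2) (-h)"
  show ?thesis
  proof
    show "norm y = 1" "norm z = 1"
      using h by (simp_all add: y_def z_def norm_mult \<nu> complex_norm power_divide)
    have "\<nu> \<noteq> 0" using \<nu> by auto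
    then show "y \<noteq> z" using h by (simp add: y_def z_def)
    show "y + z = w" by (simp add: y_def z_def w complex_eq_iff algebra_simps)
    have "Complex (r/2) h * Complex (r/2) (-h) = 1"
      using h by (simp add: complex_eq_iff power2_eq_square)
    then show "y * z = v" unfolding y_def z_def using \<nu>2 by algebra
  qed
qed

text \<open>The roots are finite in number; \<open>x\<close> itself may be one, since only a
  punctured neighbourhood counts.\<close>

lemma eventually_not_root:
  fixes Q :: "complex poly"
  assumes "Q \<noteq> 0"
  shows "\<forall>\<^sub>F \<xi> in at x within S. poly Q \<xi> \<noteq> 0"
proof -
  have "finite ({\<xi>. poly Q \<xi> = 0} - {x})" using assms by (simp add: poly_roots_finite)
  then have "open (- ({\<xi>. poly Q \<xi> = 0} - {x}))" by (intro open_Compl finite_imp_closed)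
  then show ?thesis unfolding eventually_at_topological by fastforce
qed

text \<open>Guarantees that a property holding eventually near \<open>x\<close> on the circle has a
  witness.\<close>

lemma at_within_unit_circle_neq_bot:
  assumes "norm (x :: complex) = 1"
  shows "at x within sphere 0 1 \<noteq> bot"
proof -
  have "x islimpt sphere 0 1"
  proof (rule connected_imp_perfect)
    show "connected (sphere (0::complex) 1)" by (simp add: connected_sphere)
    show "x \<in> sphere 0 1" using assms by simp
    show "sphere (0::complex) 1 \<noteq> {a}" for a
    proof
      assume "sphere (0::complex) 1 = {a}"
      moreover have "1 \<in> sphere (0::complex) 1" "-1 \<in> sphere (0::complex) 1" by simp_all
      ultimately have "(1::complex) = -1" by (metis singletonD)
      then show False by simp
    qed
  qed
  then show ?thesis by (simp add: trivial_limit_within)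
qed

text \<open>The first vertex \<open>t\<close> determines the product \<open>s t\<close> of the vertices, hence the sum \<open>w t\<close> and the
product \<open>v t\<close> of the other two, which are distinct points of the circle as soon as \<open>|w t| < 2\<close>. The
remaining requirements are the open condition \<open>E t \<noteq> 0\<close>, and \<open>poly Q t \<noteq> 0\<close>, which
expresses that \<open>|x + y + z|\<close> has changed.\<close>
lemma triangle_perturbation:
  fixes k N x y z :: complex
  assumes unit: "norm x = 1" "norm y = 1" "norm z = 1"
    and neq: "x \<noteq> y" "y \<noteq> z" "x \<noteq> z"
    and sum: "x + y + z = 2 * k + cnj N * (x * y * z)"
    and k0: "k \<noteq> 0" and N0: "N \<noteq> 0"
    and A0: "1 - 2 * cnj k * x + cnj N * x\<^sup>2 \<noteq> 0"
    and off: "chord_offset k x y \<noteq> 0" "chord_offset k y z \<noteq> 0" "chord_offset k x z \<noteq> 0"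
  obtains x' y' z' where "norm x' = 1" "norm y' = 1" "norm z' = 1"
    "x' \<noteq> y'" "y' \<noteq> z'" "x' \<noteq> z'"
    "x' + y' + z' = 2 * k + cnj N * (x' * y' * z')"
    "chord_offset k x' y' \<noteq> 0" "chord_offset k y' z' \<noteq> 0" "chord_offset k x' z' \<noteq> 0"
    "norm (x' + y' + z') \<noteq> norm (x + y + z)"
proof -
  define k' N' where "k' = cnj k" and "N' = cnj N"
  define X Y Z where "X = cnj x" and "Y = cnj y" and "Z = cnj z"
  define A where "A = (\<lambda>t. 1 - 2 * k' * t + N' * t\<^sup>2)"
  define C where "C = (\<lambda>t. t\<^sup>2 - 2 * k * t + N)"
  define s where "s = (\<lambda>t. t * C t / A t)"
  define v where "v = (\<lambda>t. C t / A t)"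
  define w where "w = (\<lambda>t. 2 * k + N' * s t - t)"
  \<comment> \<open>Written through the sum \<open>w t\<close> and product \<open>v t\<close> only,
    so that its continuity requires no continuous choice of the two other vertices.\<close>
  define E where "E = (\<lambda>t. (t\<^sup>2 - w t * t + v t) *
      ((t - k)\<^sup>2 + (t - k) * (1 - k' * t) * w t + (1 - k' * t)\<^sup>2 * v t) * (w t - k - k' * v t))"
  have E: "E t = (t - p) * (t - q) * chord_offset k t p * chord_offset k t q * chord_offset k p q"
    if "p + q = w t" "p * q = v t" for t p q
    unfolding E_def that [symmetric] chord_offset_def k'_def [symmetric] by algebra
  have u: "x * X = 1" "y * Y = 1" "z * Z = 1"
    using unit by (simp_all add: cnj_unit X_def Y_def Z_def)
  have sum1: "x + y + z = 2 * k + N' * (x * y * z)" using sum by (simp add: N'_def)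
  have "X + Y + Z = 2 * k' + N * (X * Y * Z)"
    using arg_cong [OF sum, of cnj] by (simp add: X_def Y_def Z_def k'_def)
  then have sum2: "x * y + y * z + x * z = 2 * k' * (x * y * z) + N"
    using u by algebra
  have Ax: "A x \<noteq> 0" using A0 by (simp add: A_def k'_def N'_def)
  have "y * z * A x = C x" using sum1 sum2 unfolding A_def C_def by algebra
  then have vx: "y * z = v x" using Ax by (simp add: v_def field_simps)
  have sx: "s x = x * y * z" unfolding mult.assoc vx by (simp add: s_def v_def)
  have wx: "y + z = w x" using sum1 by (simp add: w_def sx algebra_simps)
  have Ex: "E x \<noteq> 0" unfolding E [OF wx vx] using neq off by simp
  have "norm (w x) < 2"
  proof -
    \<comment> \<open>Equality in the triangle inequality would make the two unit vectors
      equal.\<close>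
    have "norm (y + z) \<noteq> 2"
    proof
      assume "norm (y + z) = 2"
      then have "norm (y + z) = norm y + norm z" using unit by simp
      then have "norm y *\<^sub>R z = norm z *\<^sub>R y" by (rule norm_triangle_eq [THEN iffD1])
      then have "y = z" using unit by simp
      then show False using neq by simp
    qed
    moreover have "norm (y + z) \<le> 2" using norm_triangle_ineq [of y z] unit by simp
    ultimately show ?thesis by (simp add: wx)
  qed
  moreover have "isCont (\<lambda>t. norm (w t)) x" 
    unfolding w_def s_def A_def C_def using Ax by (intro continuous_intros) (simp add: A_def)
  ultimately have ev1: "\<forall>\<^sub>F t in at x within sphere 0 1. norm (w t) < 2"
    by (intro order_tendstoD(2) [where y = "norm (w x)"]) (auto simp: isCont_def intro: tendsto_within_subset)
  have "isCont E x"
    unfolding E_def w_def v_def s_def A_def C_def using Ax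
    by (intro continuous_intros) (simp_all add: A_def)
  then have ev2: "\<forall>\<^sub>F t in at x within sphere 0 1. E t \<noteq> 0"
    using Ex by (intro tendsto_imp_eventually_ne [where c = "E x"]) (auto simp: isCont_def intro: tendsto_within_subset)
  have "isCont A x" unfolding A_def by (intro continuous_intros)
  then have ev3: "\<forall>\<^sub>F t in at x within sphere 0 1. A t \<noteq> 0"
    using Ax by (intro tendsto_imp_eventually_ne [where c = "A x"]) (auto simp: isCont_def intro: tendsto_within_subset)
  define m where "m = (x + y + z) * cnj (x + y + z)"
  define pA pC pX where "pA = [:1, - 2 * k', N':]" and "pC = [:N, - 2 * k, 1:]" and "pX = [:0, 1::complex:]"
  \<comment> \<open>The equation \<open>(2 * k + N' * s t) * cnj (2 * k + N' * s t) = m\<close>,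
    multiplied by \<open>s t\<close> and cleared of the denominators \<open>A t\<close>.\<close>
  define Q where "Q = ([:2 * k:] * pA + [:N':] * pX * pC) * ([:2 * k':] * pX * pC + [:N:] * pA)
      - [:m:] * pX * pC * pA"
  have Q: "poly Q t = (2 * k * A t + N' * t * C t) * (2 * k' * t * C t + N * A t) - m * t * C t * A t" for t
    by (simp add: Q_def pA_def pC_def pX_def A_def C_def power2_eq_square algebra_simps)
  \<comment> \<open>The value is \<open>2 * k * N\<close>: here it matters that the circumcentre is
    neither the centre nor a focus.\<close>
  have "poly Q 0 \<noteq> 0"
    unfolding Q using k0 N0 by (simp add: A_def C_def)
  then have "Q \<noteq> 0" by auto
  then have ev4: "\<forall>\<^sub>F t in at x within sphere 0 1. poly Q t \<noteq> 0"
    by (rule eventually_not_root)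
  have ev5: "\<forall>\<^sub>F t in at x within sphere 0 1. t \<in> sphere 0 1"
    by (simp add: eventually_at_filter)
  have "\<forall>\<^sub>F t in at x within sphere 0 1.
      norm (w t) < 2 \<and> E t \<noteq> 0 \<and> A t \<noteq> 0 \<and> poly Q t \<noteq> 0 \<and> t \<in> sphere 0 1"
    using ev1 ev2 ev3 ev4 ev5 by eventually_elim blast
  then obtain t where t: "norm (w t) < 2" "E t \<noteq> 0" "A t \<noteq> 0" "poly Q t \<noteq> 0" "norm t = 1"
    using eventually_happens' [OF at_within_unit_circle_neq_bot [OF unit(1)]] by fastforce
  have tt: "t * cnj t = 1" using t by (simp add: cnj_unit)
  \<comment> \<open>On the circle \<open>C t\<close> and \<open>A t\<close> have equal modulus,
    whence \<open>v t\<close> is a unit number.\<close>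
  have CA: "C t = t\<^sup>2 * cnj (A t)"
    using tt by (simp add: C_def A_def k'_def N'_def, algebra)
  have nv: "norm (v t) = 1"
    using t by (simp add: v_def CA norm_mult norm_divide norm_power)
  have vA: "v t * A t = C t" using t by (simp add: v_def)
  have sv: "s t = t * v t" by (simp add: s_def v_def)
  have vv: "v t * cnj (v t) = 1" using nv by (rule cnj_unit)
  \<comment> \<open>Self-conjugacy of the quadratic with sum \<open>w t\<close> and product
    \<open>v t\<close>, needed for its roots to lie on the circle.\<close>
  have wv: "w t = v t * cnj (w t)"
  proof -
    have "cnj (w t) = 2 * k' + N * (cnj t * cnj (v t)) - cnj t"
      by (simp add: w_def sv k'_def N'_def)
    moreover have "w t = 2 * k + N' * (t * v t) - t" by (simp add: w_def sv)
    ultimately show ?thesis using tt vv vA unfolding A_def C_def by algebra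
  qed
  obtain p q where pq: "norm p = 1" "norm q = 1" "p \<noteq> q" "p + q = w t" "p * q = v t"
    using unit_roots_quadratic [OF nv wv t(1)] by blast
  have s1: "t + p + q = 2 * k + N' * s t" using pq by (simp add: w_def algebra_simps)
  have s2: "s t = t * p * q" using pq by (simp add: sv)
  have nE: "(t - p) * (t - q) * chord_offset k t p * chord_offset k t q * chord_offset k p q \<noteq> 0"
    using t(2) E [OF pq(4,5)] by simp
  have "norm (t + p + q) \<noteq> norm (x + y + z)"
  proof
    assume "norm (t + p + q) = norm (x + y + z)"
    then have "(t + p + q) * cnj (t + p + q) = m"
      unfolding m_def complex_norm_square [symmetric] by simp
    then have "(2 * k + N' * s t) * (2 * k' + N * cnj (s t)) = m"
      unfolding s1 by (simp add: k'_def N'_def)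
    then have "m * s t = (2 * k + N' * s t) * (2 * k' * s t + N * (s t * cnj (s t)))"
      by (auto simp: algebra_simps)
    moreover have "s t * cnj (s t) = 1"
      unfolding sv complex_cnj_mult using tt vv by algebra
    ultimately have "m * s t = (2 * k + N' * s t) * (2 * k' * s t + N)" by simp
    moreover have "t * C t = s t * A t" using vA by (simp add: sv)
    ultimately have "poly Q t = 0" unfolding Q by algebra
    then show False using t by simp
  qed
  then show ?thesis
    using that [of t p q] t pq nE s1 s2 by (auto simp: N'_def)
qed

text \<open>The two sides differ by \<open>4 * s * a\<^sup>2 * b\<^sup>2 / R^4\<close> up to sign.
  This supplies the nondegeneracy required by \<open>vertex_not_focus\<close>.\<close>

lemma conic_parameters_nondegenerate:
  fixes a b R :: real and u :: complex and hyp :: bool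
  assumes "central_conic c u a b" "R > 0"
  defines "s \<equiv> conic_sign hyp"
  defines "K \<equiv> of_real ((a\<^sup>2 - s * b\<^sup>2) / R\<^sup>2) * u\<^sup>2"
  shows "K * cnj K \<noteq> (of_real ((a\<^sup>2 + s * b\<^sup>2) / R\<^sup>2))\<^sup>2"
proof
  have ab: "a > 0" "b > 0" and "u * cnj u = 1"
    using assms(1) by (auto simp: central_conic_def cnj_unit)
  then have "u\<^sup>2 * (cnj u)\<^sup>2 = 1" by (simp flip: power_mult_distrib)
  then have "K * cnj K = of_real (((a\<^sup>2 - s * b\<^sup>2) / R\<^sup>2)\<^sup>2)"
    unfolding K_def by (simp add: power2_eq_square mult_ac)
  moreover assume "K * cnj K = (of_real ((a\<^sup>2 + s * b\<^sup>2) / R\<^sup>2))\<^sup>2"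
  ultimately have "((a\<^sup>2 - s * b\<^sup>2) / R\<^sup>2)\<^sup>2 = ((a\<^sup>2 + s * b\<^sup>2) / R\<^sup>2)\<^sup>2"
    by (metis of_real_eq_iff of_real_power)
  then have "(a\<^sup>2 - s * b\<^sup>2)\<^sup>2 = (a\<^sup>2 + s * b\<^sup>2)\<^sup>2"
    using assms(2) by (simp add: power_divide)
  then have "s * (a\<^sup>2 * b\<^sup>2) = 0" by (auto simp: power2_sum power2_diff)
  then show False using ab by (simp add: s_def conic_sign_def split: if_splits)
qed

section \<open>Transfer to the unit circle and both directions of the equivalence\<close>

theorem theorem5p1:
  fixes c u :: complex and a b :: real and hyp :: bool and A B C :: complex
  assumes "central_conic c u a b"
    and "nondegenerate_triangle A B C"
    and "circumscribed_about c u a b hyp A B C"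
  shows "(\<exists>k. \<forall>X Y Z. nondegenerate_triangle X Y Z
            \<and> dist X (circumcenter A B C) = dist A (circumcenter A B C)
            \<and> dist Y (circumcenter A B C) = dist A (circumcenter A B C)
            \<and> dist Z (circumcenter A B C) = dist A (circumcenter A B C)
            \<and> circumscribed_about c u a b hyp X Y Z
            \<longrightarrow> sin_sq_sum X Y Z = k)
     \<longleftrightarrow> (circumcenter A B C = c \<or> circumcenter A B C \<in> conic_foci c u a b hyp)"
proof -
  define M where "M = circumcenter A B C"
  define R where "R = dist A M"
  define s where "s = conic_sign hyp"
  \<comment> \<open>The parameters of the conic after the similarity that carries the circumcircle
    to the unit circle.\<close>
  define k where "k = (c - M) / of_real R"
  define K where "K = of_real ((a\<^sup>2 - s * b\<^sup>2) / R\<^sup>2) * u\<^sup>2"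
  define S where "S = (a\<^sup>2 + s * b\<^sup>2) / R\<^sup>2"
  define N where "N = k\<^sup>2 - K"
  define pt where "pt = (\<lambda>x. M + of_real R * x)"
  define family where "family = (\<lambda>X Y Z. nondegenerate_triangle X Y Z
    \<and> dist X M = R \<and> dist Y M = R \<and> dist Z M = R \<and> circumscribed_about c u a b hyp X Y Z)"
  define triple where "triple = (\<lambda>x y z. norm x = 1 \<and> norm y = 1 \<and> norm z = 1
    \<and> x \<noteq> y \<and> y \<noteq> z \<and> x \<noteq> z \<and> chord_tangent k K S x y
    \<and> chord_tangent k K S y z \<and> chord_tangent k K S x z)"
  have eqd: "dist B M = R" "dist C M = R"
    using circumcenter_equidistant [OF assms(2)] by (simp_all add: R_def M_def dist_commute)
  have R: "R > 0"
  proof (rule ccontr)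
    assume "\<not> R > 0"
    then have "A = M" "B = M" using eqd by (simp_all add: R_def)
    then show False using nondegenerate_triangle_distinct [OF assms(2)] by simp
  qed
  have family_triple: "family (pt x) (pt y) (pt z) \<longleftrightarrow> triple x y z"
    if unit: "norm x = 1" "norm y = 1" "norm z = 1" for x y z
  proof (cases "x \<noteq> y \<and> y \<noteq> z \<and> x \<noteq> z")
    case True
    have "dist (pt t) M = R" if "norm t = 1" for t
      using that R by (simp add: pt_def dist_norm norm_mult)
    then have "family (pt x) (pt y) (pt z) \<longleftrightarrow> circumscribed_about c u a b hyp (pt x) (pt y) (pt z)"
      using nondegenerate_triangle_inscribed [OF unit, of R M] True R unit
      by (simp add: family_def pt_def)
    also have "\<dots> \<longleftrightarrow> triple x y z"
      using True unit tangent_line_chord [OF assms(1) R, of _ _ hyp M]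
      by (auto simp: circumscribed_about_def triple_def pt_def k_def K_def S_def s_def chord_tangent_commute)
    finally show ?thesis .
  next
    case False
    then show ?thesis
      using nondegenerate_triangle_distinct [of "pt x" "pt y" "pt z"] by (auto simp: family_def triple_def)
  qed
  have pt_surj: "\<exists>x. norm x = 1 \<and> X = pt x" if "dist X M = R" for X
    using that R
    by (intro exI [of _ "(X - M) / of_real R"]) (simp add: pt_def dist_norm norm_divide)
  have sum: "x + y + z = 2 * k + cnj N * (x * y * z)" if "triple x y z" for x y z
    using that unfolding triple_def N_def by (blast intro: tangent_triangle_sum)
  have sin: "sin_sq_sum (pt x) (pt y) (pt z) = (9 - (norm (x + y + z))\<^sup>2) / 4" if "triple x y z" for x y z
    using that R unfolding triple_def pt_def by (blast intro: sin_sq_sum_inscribed)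
  have "family A B C" using assms eqd by (simp add: family_def R_def)
  moreover obtain x y z where xyz: "norm x = 1" "norm y = 1" "norm z = 1" "A = pt x" "B = pt y" "C = pt z"
    using pt_surj eqd R_def by metis
  ultimately have T: "triple x y z" using family_triple by simp
  have centre: "M = c \<longleftrightarrow> k = 0" using R by (auto simp: k_def)
  have foci: "M \<in> conic_foci c u a b hyp \<longleftrightarrow> N = 0"
  proof -
    have "M \<in> conic_foci c u a b hyp \<longleftrightarrow> (M - c)\<^sup>2 = of_real (a\<^sup>2 - s * b\<^sup>2) * u\<^sup>2"
      using conic_foci_iff assms(1) by (simp add: central_conic_def s_def)
    also have "\<dots> \<longleftrightarrow> of_real (R\<^sup>2) * N = 0"
      using R by (simp add: N_def k_def K_def power_divide right_diff_distrib power2_commute [of M])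
    finally show ?thesis using R by simp
  qed
  have "(\<exists>v. \<forall>X Y Z. family X Y Z \<longrightarrow> sin_sq_sum X Y Z = v) \<longleftrightarrow> k = 0 \<or> N = 0"
  proof
    assume kN: "k = 0 \<or> N = 0"
    \<comment> \<open>One formula serves both cases: one of the two norms is zero, and
      \<open>x * y * z\<close> has modulus 1.\<close>
    have "sin_sq_sum X Y Z = (9 - (norm (2 * k) + norm N)\<^sup>2) / 4" if fam: "family X Y Z" for X Y Z
    proof -
      obtain x y z where u: "norm x = 1" "norm y = 1" "norm z = 1" and X: "X = pt x" "Y = pt y" "Z = pt z"
        using pt_surj fam unfolding family_def by metis
      then have t: "triple x y z" using fam family_triple by simp
      have "norm (2 * k + cnj N * (x * y * z)) = norm (2 * k) + norm N"
        using kN u by (auto simp: norm_mult)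
      then show ?thesis unfolding X sin [OF t] sum [OF t] by simp
    qed
    then show "\<exists>v. \<forall>X Y Z. family X Y Z \<longrightarrow> sin_sq_sum X Y Z = v" by blast
  next
    assume const: "\<exists>v. \<forall>X Y Z. family X Y Z \<longrightarrow> sin_sq_sum X Y Z = v"
    show "k = 0 \<or> N = 0"
    proof (rule ccontr)
      assume "\<not> (k = 0 \<or> N = 0)"
      then have k0: "k \<noteq> 0" and N0: "N \<noteq> 0" by auto
      have off: "chord_offset k x y \<noteq> 0" "chord_offset k y z \<noteq> 0" "chord_offset k x z \<noteq> 0"
        and neq: "x \<noteq> y" "y \<noteq> z" "x \<noteq> z" and tan: "chord_tangent k K S x y"
        using T by (simp_all add: triple_def chord_tangent_def)
      have "K * cnj K \<noteq> (of_real S)\<^sup>2"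
        unfolding K_def S_def s_def using assms(1) R by (rule conic_parameters_nondegenerate)
      then have "1 - 2 * cnj k * x + cnj N * x\<^sup>2 \<noteq> 0"
        unfolding N_def using vertex_not_focus tan xyz by blast
      from triangle_perturbation [OF xyz(1-3) neq sum [OF T] k0 N0 this off]
      obtain x' y' z' where new: "norm x' = 1" "norm y' = 1" "norm z' = 1"
          "x' \<noteq> y'" "y' \<noteq> z'" "x' \<noteq> z'"
          "x' + y' + z' = 2 * k + cnj N * (x' * y' * z')"
          "chord_offset k x' y' \<noteq> 0" "chord_offset k y' z' \<noteq> 0" "chord_offset k x' z' \<noteq> 0"
        and norm: "norm (x' + y' + z') \<noteq> norm (x + y + z)" .
      \<comment> \<open>The tangent side \<open>x y\<close> of the given triangle makes the defect
        vanish; the resulting identity \<open>Fuss\<close> no longer mentions the triangle and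
        yields tangency for the perturbed one.\<close>
      have "x * y * (1 + (k\<^sup>2 - K) * cnj (k\<^sup>2 - K) - 2 * k * cnj k - 2 * of_real S) = 0"
        using chord_defect [OF xyz(1-3) sum [OF T, unfolded N_def], of S] tan
        by (simp add: chord_tangent_def)
      moreover have "x * y \<noteq> 0" using xyz by auto
      ultimately have Fuss: "1 + (k\<^sup>2 - K) * cnj (k\<^sup>2 - K) - 2 * k * cnj k - 2 * of_real S = 0"
        by (metis mult_eq_0_iff)
      have tangent: "chord_tangent k K S p q"
        if "norm p = 1" "norm q = 1" "norm r = 1" "p + q + r = 2 * k + cnj N * (p * q * r)"
          "chord_offset k p q \<noteq> 0" for p q r
        using chord_defect [OF that(1-3) that(4) [unfolded N_def], of S] that(5)
        unfolding Fuss by (simp add: chord_tangent_def)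
      have "chord_tangent k K S x' y'" "chord_tangent k K S y' z'" "chord_tangent k K S x' z'"
        using new by (auto intro: tangent [of x' y' z'] tangent [of y' z' x'] tangent [of x' z' y'] simp: ac_simps)
      then have T': "triple x' y' z'" using new by (simp add: triple_def)
      then have "family (pt x') (pt y') (pt z')" using family_triple new by simp
      moreover have "family (pt x) (pt y) (pt z)" using family_triple T xyz by simp
      ultimately have "sin_sq_sum (pt x') (pt y') (pt z') = sin_sq_sum (pt x) (pt y) (pt z)"
        using const by metis
      then have "(norm (x' + y' + z'))\<^sup>2 = (norm (x + y + z))\<^sup>2"
        unfolding sin [OF T] sin [OF T'] by simp
      then show False using norm by (simp add: power2_eq_iff_nonneg)
    qed
  qed
  then show ?thesis
    unfolding centre [symmetric] foci [symmetric] family_def M_def R_def by simp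
qed

end
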